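(* Let $\mathfrak{U}$ be a set and let $\mathcal{B}\subseteq\mathcal{P}(\mathfrak{U})\setminus\{\emptyset\}$ be a directed family (not necessarily unpackable) with $\mathfrak{U}\in\mathcal{B}$. Let $X\subseteq\mathfrak{U}$ be constructible and let $\mathcal{S},\mathcal{T}\subseteq\mathcal{B}$ be finite with $\mathrm{Ch}(\mathcal{S})=\mathrm{Ch}(\mathcal{T})=X$. If $(\mathcal{S},\subseteq)$ and $(\mathcal{T},\subseteq)$ are both $\unlhd$-minimal among all finite $\mathcal{R}\subseteq\mathcal{B}$ with $\mathrm{Ch}(\mathcal{R})=X$, then $\mathcal{S}=\mathcal{T}$.
   Context: A family $\mathcal{B}\subseteq\mathcal{P}(\mathfrak{U})\setminus\{\emptyset\}$ is directed if for all $B_0,B_1\in\mathcal{B}$ one has $B_0\subseteq B_1$, $B_1\subseteq B_0$, or $B_0\cap B_1=\emptyset$; its members are balls, and a constructible set is a finite boolean combination of balls. For a finite set $\mathcal{S}$ of balls (a finite forest under $\subseteq$), define $\mathrm{Lev}_n(\mathcal{S})$ inductively as the set of $\subseteq$-maximal elements of $\mathcal{S}\setminus\bigcup_{i<n}\mathrm{Lev}_i(\mathcal{S})$; write $\lambda(B,\mathcal{S})=n$ if $B\in\mathrm{Lev}_n(\mathcal{S})$, $\mathrm{Sub}(B,\mathcal{S})=\{C\in\mathrm{Lev}_{\lambda(B,\mathcal{S})+1}(\mathcal{S}): C\subseteq B\}$, and $\mathrm{Ch}(\mathcal{S})=\bigcup_{n\ge0}\bigcup_{B\in\mathrm{Lev}_{2n}(\mathcal{S})}\big(B\setminus\bigcup\mathrm{Sub}(B,\mathcal{S})\big)$.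 On finite forests define the quasi-order $\mathcal{S}\unlhd\mathcal{T}$ iff one of: (i) $|\mathcal{S}|=|\mathcal{T}|$ and $|\mathrm{Lev}_n(\mathcal{S})|=|\mathrm{Lev}_n(\mathcal{T})|$ for all $n$; (ii) $|\mathcal{S}|<|\mathcal{T}|$; (iii) $|\mathcal{S}|=|\mathcal{T}|$ and for some $n$, $|\mathrm{Lev}_i(\mathcal{S})|=|\mathrm{Lev}_i(\mathcal{T})|$ for all $i<n$ but $|\mathrm{Lev}_n(\mathcal{S})|>|\mathrm{Lev}_n(\mathcal{T})|$. *)

theory Defs
  imports Main
begin

definition directed_family :: "'a set \<Rightarrow> 'a set set \<Rightarrow> bool" where
  "directed_family U \<B> \<longleftrightarrow>
     \<B> \<subseteq> Pow U - {{}} \<and>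
     (\<forall>B\<^sub>0\<in>\<B>. \<forall>B\<^sub>1\<in>\<B>. B\<^sub>0 \<subseteq> B\<^sub>1 \<or> B\<^sub>1 \<subseteq> B\<^sub>0 \<or> B\<^sub>0 \<inter> B\<^sub>1 = {})"

inductive constructible :: "'a set \<Rightarrow> 'a set set \<Rightarrow> 'a set \<Rightarrow> bool"
  for U :: "'a set" and \<B> :: "'a set set" where
  ball: "B \<in> \<B> \<Longrightarrow> constructible U \<B> B"
| compl: "constructible U \<B> X \<Longrightarrow> constructible U \<B> (U - X)"
| union: "constructible U \<B> X \<Longrightarrow> constructible U \<B> Y \<Longrightarrow> constructible U \<B> (X \<union> Y)"
| inter: "constructible U \<B> X \<Longrightarrow> constructible U \<B> Y \<Longrightarrow> constructible U \<B> (X \<inter> Y)"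

definition maximal_elems :: "'a set set \<Rightarrow> 'a set set" where
  "maximal_elems \<S> = {B \<in> \<S>. \<forall>C\<in>\<S>. B \<subseteq> C \<longrightarrow> C = B}"

function Lev :: "nat \<Rightarrow> 'a set set \<Rightarrow> 'a set set" where
  "Lev n \<S> = maximal_elems (\<S> - (\<Union>i\<in>{..<n}. Lev i \<S>))"
  by auto
termination by (relation "measure fst") auto

declare Lev.simps [simp del]

text \<open>Meaningful only when \<open>B\<close> lies in some level of \<open>\<S>\<close>, in particular for \<open>\<S>\<close> finite
  and \<open>B \<in> \<S>\<close>; the levels are pairwise disjoint, so the description is then proper
  (see \<open>level_eqI\<close>).\<close>

definition level :: "'a set \<Rightarrow> 'a set set \<Rightarrow> nat" where
  "level B \<S> = (THE n. B \<in> Lev n \<S>)"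

definition Sub :: "'a set \<Rightarrow> 'a set set \<Rightarrow> 'a set set" where
  "Sub B \<S> = {C \<in> Lev (level B \<S> + 1) \<S>. C \<subseteq> B}"

definition Ch :: "'a set set \<Rightarrow> 'a set" where
  "Ch \<S> = (\<Union>n. \<Union>B\<in>Lev (2 * n) \<S>. B - \<Union>(Sub B \<S>))"

definition forest_le :: "'a set set \<Rightarrow> 'a set set \<Rightarrow> bool" (infix "\<unlhd>" 50) where
  "\<S> \<unlhd> \<T> \<longleftrightarrow>
     (card \<S> = card \<T> \<and> (\<forall>n. card (Lev n \<S>) = card (Lev n \<T>))) \<or>
     card \<S> < card \<T> \<or>
     (card \<S> = card \<T> \<and>
       (\<exists>n. (\<forall>i<n. card (Lev i \<S>) = card (Lev i \<T>)) \<and> card (Lev n \<S>) > card (Lev n \<T>)))"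

text \<open>Minimality in the sense of a quasi-order: nothing in the family is strictly below.\<close>

definition forest_minimal_in :: "'a set set \<Rightarrow> 'a set set set \<Rightarrow> bool" where
  "forest_minimal_in \<S> \<F> \<longleftrightarrow> \<S> \<in> \<F> \<and> (\<forall>\<R>\<in>\<F>. \<R> \<unlhd> \<S> \<longrightarrow> \<S> \<unlhd> \<R>)"

lemma Lev_disjoint:
  assumes "B \<in> Lev m \<S>" "B \<in> Lev n \<S>"
  shows "m = n"
proof -
  have False if "i < j" "B \<in> Lev i \<S>" "B \<in> Lev j \<S>" for i j
    using that(3) unfolding Lev.simps[of j] maximal_elems_def using that(1,2) by auto
  with assms show ?thesis by (meson linorder_neqE_nat)
qed

lemma level_eqI: "B \<in> Lev n \<S> \<Longrightarrow> level B \<S> = n"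
  unfolding level_def by (blast intro: the_equality Lev_disjoint)

end

theory Submission
  imports Defs
begin

text \<open>A point lies in \<open>Ch \<S>\<close> iff it lies in an odd number of balls of \<open>\<S>\<close>, and the
  level of a ball is the number of its strict supersets in \<open>\<S>\<close>. If two minimal forests
  differ, let \<open>B\<close> be a maximal ball of their symmetric difference, say \<open>B \<in> \<S>\<close>. Both
  forests agree above \<open>B\<close>, so their parts inside \<open>B\<close> can be exchanged without affecting
  the represented set or any level outside \<open>B\<close>; by minimality these parts have equally
  many balls on each level. As \<open>B\<close> is the only root of the part of \<open>\<S>\<close>, the part of \<open>\<T>\<close> has
  a single root \<open>E \<subset> B\<close>. Hence \<open>\<S>\<close> covers every point of \<open>B - E\<close> by a further ball inside \<open>B\<close>.
  Replacing the part of \<open>\<S>\<close> inside \<open>B\<close> by its part inside \<open>E\<close>, with \<open>E\<close> added or removed to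
  correct the parity, loses at least two balls and gains at most one: a contradiction.\<close>

section \<open>Depth in a directed family and the parity description of \<open>Ch\<close>\<close>

lemma directed_family_subset:
  "directed_family U \<B> \<Longrightarrow> \<S> \<subseteq> \<B> \<Longrightarrow> directed_family U \<S>"
  unfolding directed_family_def by blast

lemma directed_family_comparable:
  assumes "directed_family U \<B>" "B \<in> \<B>" "C \<in> \<B>" "x \<in> B" "x \<in> C"
  shows "B \<subseteq> C \<or> C \<subset> B"
  using assms unfolding directed_family_def by blast

lemma directed_family_nonempty:
  assumes "directed_family U \<B>" "B \<in> \<B>"
  obtains x where "x \<in> B"
  using assms unfolding directed_family_def by blast

text \<open>A closed form for the level of a ball, which avoids the recursion in
  \<open>Lev\<close>.\<close>

definition depth :: "'a set set \<Rightarrow> 'a set \<Rightarrow> nat" where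
  "depth \<S> B = card {C \<in> \<S>. B \<subset> C}"

lemma depth_less:
  assumes "finite \<S>" "C \<in> \<S>" "B \<subset> C"
  shows "depth \<S> C < depth \<S> B"
  unfolding depth_def by (rule psubset_card_mono) (use assms in auto)

text \<open>All strict supersets of \<open>B\<close> share a point of \<open>B\<close>, so they form
  a chain. Its least member \<open>C\<close> works: the rest of the chain is exactly the set of
  strict supersets of \<open>C\<close>.\<close>

lemma depth_predecessor:
  assumes dir: "directed_family U \<S>" and fin: "finite \<S>" and B: "B \<in> \<S>"
    and pos: "depth \<S> B > 0"
  obtains C where "C \<in> \<S>" "B \<subset> C" "depth \<S> B = Suc (depth \<S> C)"
proof -
  have "{C \<in> \<S>. B \<subset> C} \<noteq> {}"
    using pos unfolding depth_def by (metis card.empty less_irrefl)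
  then obtain C where C: "C \<in> {C \<in> \<S>. B \<subset> C}"
      and min: "\<forall>D\<in>{C \<in> \<S>. B \<subset> C}. D \<subseteq> C \<longrightarrow> C = D"
    using finite_has_minimal[of "{C \<in> \<S>. B \<subset> C}"] fin by auto
  obtain x where x: "x \<in> B"
    using directed_family_nonempty[OF dir B] .
  have "{D \<in> \<S>. B \<subset> D} = insert C {D \<in> \<S>. C \<subset> D}"
  proof (intro subset_antisym subsetI)
    fix D assume D: "D \<in> {D \<in> \<S>. B \<subset> D}"
    then have "C \<subseteq> D \<or> D \<subset> C"
      using directed_family_comparable[OF dir, of C D x] C x by auto
    then show "D \<in> insert C {D \<in> \<S>. C \<subset> D}"
      using D min by auto
  qed (use C in auto)
  then have "depth \<S> B = Suc (depth \<S> C)"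
    unfolding depth_def using fin by simp
  then show thesis using that C by blast
qed

text \<open>By strong induction the earlier levels remove exactly the balls of depth below
  \<open>n\<close>. Depth drops strictly on passing to a superset, so balls of depth
  \<open>n\<close> are maximal in the remainder; a deeper ball is not, since its predecessor is
  still there.\<close>

lemma Lev_eq_depth:
  assumes dir: "directed_family U \<S>" and fin: "finite \<S>"
  shows "Lev n \<S> = {B \<in> \<S>. depth \<S> B = n}"
proof (induction n rule: less_induct)
  case (less n)
  then have "\<S> - (\<Union>i\<in>{..<n}. Lev i \<S>) = {B \<in> \<S>. n \<le> depth \<S> B}"
    by auto
  then have lev: "Lev n \<S> = maximal_elems {B \<in> \<S>. n \<le> depth \<S> B}"
    by (simp add: Lev.simps[of n])
  show ?case
  proof (intro subset_antisym subsetI)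
    fix B assume B: "B \<in> Lev n \<S>"
    have "depth \<S> B = n"
    proof (rule ccontr)
      assume "depth \<S> B \<noteq> n"
      then have gt: "n < depth \<S> B"
        using B unfolding lev maximal_elems_def by auto
      then obtain C where C: "C \<in> \<S>" "B \<subset> C" "depth \<S> B = Suc (depth \<S> C)"
        using depth_predecessor[OF dir fin, of B] B unfolding lev maximal_elems_def by auto
      then show False
        using B gt unfolding lev maximal_elems_def by auto
    qed
    then show "B \<in> {B \<in> \<S>. depth \<S> B = n}"
      using B unfolding lev maximal_elems_def by auto
  next
    fix B assume B: "B \<in> {B \<in> \<S>. depth \<S> B = n}"
    have "C = B" if "C \<in> \<S>" "n \<le> depth \<S> C" "B \<subseteq> C" for C
      using depth_less[OF fin \<open>C \<in> \<S>\<close>, of B] that B by fastforce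
    then show "B \<in> Lev n \<S>"
      using B unfolding lev maximal_elems_def by auto
  qed
qed

text \<open>The balls through \<open>x\<close> form a chain, on which depth is injective. Strict
  supersets of such a ball also contain \<open>x\<close>, so depths stay below the number of balls
  through \<open>x\<close>, and counting gives surjectivity.\<close>

lemma depth_image_containing:
  assumes dir: "directed_family U \<S>" and fin: "finite \<S>"
  shows "depth \<S> ` {B \<in> \<S>. x \<in> B} = {..<card {B \<in> \<S>. x \<in> B}}"
proof (rule card_subset_eq)
  show "finite {..<card {B \<in> \<S>. x \<in> B}}"
    by simp
  have "depth \<S> B < card {B \<in> \<S>. x \<in> B}" if "B \<in> \<S>" "x \<in> B" for B
    unfolding depth_def by (rule psubset_card_mono) (use that fin in auto)
  then show "depth \<S> ` {B \<in> \<S>. x \<in> B} \<subseteq> {..<card {B \<in> \<S>. x \<in> B}}"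
    by auto
  have "inj_on (depth \<S>) {B \<in> \<S>. x \<in> B}"
  proof (rule inj_onI)
    fix B C
    assume B: "B \<in> {B \<in> \<S>. x \<in> B}" and C: "C \<in> {B \<in> \<S>. x \<in> B}"
      and eq: "depth \<S> B = depth \<S> C"
    have "B \<subseteq> C \<or> C \<subset> B"
      using directed_family_comparable[OF dir, of B C x] B C by auto
    then show "B = C"
      using depth_less[OF fin, of C B] depth_less[OF fin, of B C] B C eq by auto
  qed
  then show "card (depth \<S> ` {B \<in> \<S>. x \<in> B}) = card {..<card {B \<in> \<S>. x \<in> B}}"
    by (simp add: card_image)
qed

text \<open>The \<open>k\<close> balls through \<open>x\<close> occupy the depths \<open>0\<close>
  to \<open>k - 1\<close>, one each, so only the deepest one has no ball through \<open>x\<close> on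
  the next level. Its depth \<open>k - 1\<close> is even iff \<open>k\<close> is odd.\<close>

lemma mem_Ch_iff_odd:
  assumes dir: "directed_family U \<S>" and fin: "finite \<S>"
  shows "x \<in> Ch \<S> \<longleftrightarrow> odd (card {B \<in> \<S>. x \<in> B})"
proof
  let ?k = "card {B \<in> \<S>. x \<in> B}"
  note im = depth_image_containing[OF dir fin, of x]
  note lev = Lev_eq_depth[OF dir fin]
  {
    assume "x \<in> Ch \<S>"
    then obtain n B where B: "B \<in> Lev (2 * n) \<S>" "x \<in> B" "x \<notin> \<Union>(Sub B \<S>)"
      unfolding Ch_def by auto
    then have Bd: "B \<in> \<S>" "depth \<S> B = 2 * n"
      by (auto simp: lev)
    show "odd ?k"
    proof
      assume "even ?k"
      moreover have "depth \<S> B \<in> depth \<S> ` {B \<in> \<S>. x \<in> B}"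
        by (rule imageI) (simp add: Bd B(2))
      then have "2 * n < ?k"
        unfolding im Bd by simp
      \<comment> \<open>An even number above \<open>2 * n\<close> is also above
        \<open>2 * n + 1\<close>, so some ball through \<open>x\<close> sits on the level just below
        \<open>B\<close>.\<close>
      ultimately have "Suc (2 * n) < ?k"
        by presburger
      then have "Suc (2 * n) \<in> depth \<S> ` {B \<in> \<S>. x \<in> B}"
        unfolding im by simp
      then obtain C where C: "C \<in> \<S>" "x \<in> C" "depth \<S> C = Suc (2 * n)"
        by auto
      have "B \<subseteq> C \<or> C \<subset> B"
        using directed_family_comparable[OF dir, of B C x] B Bd C by auto
      then have "C \<subseteq> B"
        using depth_less[OF fin, of C B] C Bd by auto
      then have "C \<in> Sub B \<S>"
        using C level_eqI[OF B(1)] unfolding Sub_def by (simp add: lev)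
      then show False
        using B(3) C(2) by blast
    qed
  next
    assume odd: "odd ?k"
    then have "?k - 1 \<in> depth \<S> ` {B \<in> \<S>. x \<in> B}"
      unfolding im using odd_pos[OF odd] by simp
    then obtain B where B: "B \<in> \<S>" "x \<in> B" "depth \<S> B = ?k - 1"
      by auto
    from odd obtain n where n: "?k = 2 * n + 1"
      by (rule oddE)
    have Bl: "B \<in> Lev (2 * n) \<S>"
      using B n by (simp add: lev)
    have "x \<notin> C" if "C \<in> Sub B \<S>" for C
    proof
      assume "x \<in> C"
      moreover have "C \<in> \<S>" "depth \<S> C = ?k"
        using that level_eqI[OF Bl] n unfolding Sub_def by (auto simp: lev)
      ultimately have "depth \<S> C \<in> depth \<S> ` {B \<in> \<S>. x \<in> B}"
        by (intro imageI) simp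
      then show False
        unfolding im using \<open>depth \<S> C = ?k\<close> by simp
    qed
    then show "x \<in> Ch \<S>"
      unfolding Ch_def using Bl B(2) by blast
  }
qed

section \<open>Exchanging the parts of two forests inside a ball\<close>

lemma card_filter_add:
  "finite A \<Longrightarrow> card A = card {x \<in> A. \<not> P x} + card {x \<in> A. P x}"
  by (subst card_Un_disjoint[symmetric]) (auto intro: arg_cong[where f = card])

text \<open>Formulated for arbitrary families, so that the same operation also acts on single levels
  in \<open>Lev_graft\<close>.\<close>

definition graft :: "'a set \<Rightarrow> 'a set set \<Rightarrow> 'a set set \<Rightarrow> 'a set set" where
  "graft B \<S> \<T> = {C \<in> \<S>. \<not> C \<subseteq> B} \<union> {C \<in> \<T>. C \<subseteq> B}"

lemma card_graft:
  assumes "finite \<S>" "finite \<T>"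
  shows "card (graft B \<S> \<T>) = card {C \<in> \<S>. \<not> C \<subseteq> B} + card {C \<in> \<T>. C \<subseteq> B}"
  unfolding graft_def by (rule card_Un_disjoint) (use assms in auto)

text \<open>A ball that meets \<open>B\<close> without lying inside it is strictly above
  \<open>B\<close>; agreement there makes the two parts inside \<open>B\<close> interchangeable. The
  assumptions are symmetric in \<S> and \<T>, so \<open>swap\<close> yields each result in both
  directions.\<close>

locale agreeing_above =
  fixes U :: "'a set" and \<B> \<S> \<T> :: "'a set set" and B :: "'a set"
  assumes dir: "directed_family U \<B>"
    and fin_S: "finite \<S>" and S_sub: "\<S> \<subseteq> \<B>"
    and fin_T: "finite \<T>" and T_sub: "\<T> \<subseteq> \<B>"
    and B_ball: "B \<in> \<B>"
    and agree: "\<And>C. B \<subset> C \<Longrightarrow> C \<in> \<S> \<longleftrightarrow> C \<in> \<T>"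
begin

lemma swap: "agreeing_above U \<B> \<T> \<S> B"
  using dir fin_S S_sub fin_T T_sub B_ball agree by unfold_locales auto

lemma finite_graft: "finite (graft B \<S> \<T>)"
  and graft_sub: "graft B \<S> \<T> \<subseteq> \<B>"
  using fin_S fin_T S_sub T_sub unfolding graft_def by auto

lemma above_if_meets:
  assumes "C \<in> \<B>" "\<not> C \<subseteq> B" "x \<in> B" "x \<in> C"
  shows "B \<subset> C"
  using directed_family_comparable[OF dir B_ball, of C x] assms by auto

text \<open>Balls reaching a point of \<open>B\<close> from outside are strictly above
  \<open>B\<close>, hence common to both forests; balls inside \<open>B\<close> do not reach points
  outside \<open>B\<close>.\<close>

lemma graft_containing:
  "{C \<in> graft B \<S> \<T>. x \<in> C} = (if x \<in> B then {C \<in> \<T>. x \<in> C} else {C \<in> \<S>. x \<in> C})"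
proof (cases "x \<in> B")
  case True
  have "B \<subset> C" if "C \<in> \<S> \<union> \<T>" "\<not> C \<subseteq> B" "x \<in> C" for C
    using above_if_meets[of C x] that True S_sub T_sub by auto
  then show ?thesis
    using True agree unfolding graft_def by auto
qed (auto simp: graft_def)

lemma Ch_graft:
  assumes "Ch \<S> = Ch \<T>"
  shows "Ch (graft B \<S> \<T>) = Ch \<S>"
proof (rule set_eqI)
  fix x
  note parity = mem_Ch_iff_odd[OF directed_family_subset[OF dir]]
  show "x \<in> Ch (graft B \<S> \<T>) \<longleftrightarrow> x \<in> Ch \<S>"
    using parity[OF graft_sub finite_graft, of x] parity[OF S_sub fin_S, of x]
      parity[OF T_sub fin_T, of x] assms by (simp add: graft_containing)
qed

lemma depth_graft_outside:
  "\<not> C \<subseteq> B \<Longrightarrow> depth (graft B \<S> \<T>) C = depth \<S> C"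
  unfolding depth_def graft_def by (rule arg_cong[where f = card]) auto

lemma depth_graft_inside:
  assumes "C \<in> \<T>" "C \<subseteq> B"
  shows "depth (graft B \<S> \<T>) C = depth \<T> C"
proof -
  obtain x where x: "x \<in> C"
    using directed_family_nonempty[OF dir, of C] assms T_sub by auto
  have "B \<subset> D" if "D \<in> \<S> \<union> \<T>" "\<not> D \<subseteq> B" "C \<subset> D" for D
    using above_if_meets[of D x] that assms x S_sub T_sub by auto
  then have "D \<in> graft B \<S> \<T> \<longleftrightarrow> D \<in> \<T>" if "C \<subset> D" for D
    using agree[of D] that unfolding graft_def by (cases "D \<subseteq> B") auto
  then have "{D \<in> graft B \<S> \<T>. C \<subset> D} = {D \<in> \<T>. C \<subset> D}"
    by blast
  then show ?thesis
    by (simp add: depth_def)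
qed

text \<open>The exchange preserves the depth of every surviving ball, because the balls above
  \<open>B\<close> are common; hence it acts on each level separately.\<close>

lemma Lev_graft: "Lev n (graft B \<S> \<T>) = graft B (Lev n \<S>) (Lev n \<T>)"
proof -
  note lev = Lev_eq_depth[OF directed_family_subset[OF dir]]
  have mem: "C \<in> graft B \<A> \<A>' \<longleftrightarrow> (if C \<subseteq> B then C \<in> \<A>' else C \<in> \<A>)" for C \<A> \<A>'
    by (auto simp: graft_def)
  show ?thesis
    unfolding lev[OF graft_sub finite_graft] lev[OF S_sub fin_S] lev[OF T_sub fin_T]
    by (rule set_eqI) (auto simp: mem depth_graft_outside depth_graft_inside)
qed

lemma finite_Lev: "finite (Lev n \<S>)"
  using fin_S Lev_eq_depth[OF directed_family_subset[OF dir S_sub] fin_S] by simp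

end

section \<open>Cardinality consequences of minimality\<close>

lemma forest_minimal_in_card_le:
  assumes "forest_minimal_in \<S> \<F>" "\<R> \<in> \<F>"
  shows "card \<S> \<le> card \<R>"
proof (rule ccontr)
  assume less: "\<not> card \<S> \<le> card \<R>"
  then have "\<R> \<unlhd> \<S>"
    unfolding forest_le_def by simp
  then have "\<S> \<unlhd> \<R>"
    using assms unfolding forest_minimal_in_def by blast
  then show False
    using less unfolding forest_le_def by auto
qed

lemma forest_minimal_in_Lev_le:
  assumes min: "forest_minimal_in \<S> \<F>" "\<R> \<in> \<F>" and card: "card \<R> = card \<S>"
    and eq: "\<And>i. i < n \<Longrightarrow> card (Lev i \<R>) = card (Lev i \<S>)"
  shows "card (Lev n \<R>) \<le> card (Lev n \<S>)"
proof (rule ccontr)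
  assume gt: "\<not> card (Lev n \<R>) \<le> card (Lev n \<S>)"
  then have "\<R> \<unlhd> \<S>"
    unfolding forest_le_def using card eq not_le by blast
  then have "\<S> \<unlhd> \<R>"
    using min unfolding forest_minimal_in_def by blast
  then obtain m where m: "\<forall>i<m. card (Lev i \<S>) = card (Lev i \<R>)"
      "card (Lev m \<S>) > card (Lev m \<R>)"
    unfolding forest_le_def using card gt by auto
  \<comment> \<open>Level \<open>n\<close> favours \<R> and level \<open>m\<close> favours \<S>,
    with equality before each, so the two first differences cannot coexist.\<close>
  then show False
    using gt eq by (cases m n rule: linorder_cases) auto
qed

section \<open>Two minimal forests compared inside a ball\<close>

context agreeing_above
begin

text \<open>The graft represents the same set, so it competes with \<S>. Both have the same balls
  outside \<open>B\<close>; these cancel from the counts and leave the parts inside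
  \<open>B\<close>.\<close>

lemma minimal_inside_Lev_le:
  assumes ch: "Ch \<S> = X" "Ch \<T> = X"
    and min: "forest_minimal_in \<S> {\<R>. finite \<R> \<and> \<R> \<subseteq> \<B> \<and> Ch \<R> = X}"
  shows "card {C \<in> \<S>. C \<subseteq> B} \<le> card {C \<in> \<T>. C \<subseteq> B}"
    and "\<lbrakk>card {C \<in> \<S>. C \<subseteq> B} = card {C \<in> \<T>. C \<subseteq> B};
      \<And>i. i < n \<Longrightarrow> card {C \<in> Lev i \<S>. C \<subseteq> B} = card {C \<in> Lev i \<T>. C \<subseteq> B}\<rbrakk>
      \<Longrightarrow> card {C \<in> Lev n \<T>. C \<subseteq> B} \<le> card {C \<in> Lev n \<S>. C \<subseteq> B}"
proof -
  have mem: "graft B \<S> \<T> \<in> {\<R>. finite \<R> \<and> \<R> \<subseteq> \<B> \<and> Ch \<R> = X}"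
    using finite_graft graft_sub Ch_graft ch by auto
  note split = card_filter_add[where P = "\<lambda>C. C \<subseteq> B"]
  show "card {C \<in> \<S>. C \<subseteq> B} \<le> card {C \<in> \<T>. C \<subseteq> B}"
    using forest_minimal_in_card_le[OF min mem] split[OF fin_S]
    by (simp add: card_graft[OF fin_S fin_T])
  have lev: "card (Lev i (graft B \<S> \<T>)) =
      card {C \<in> Lev i \<S>. \<not> C \<subseteq> B} + card {C \<in> Lev i \<T>. C \<subseteq> B}" for i
    unfolding Lev_graft
    by (rule card_graft[OF finite_Lev agreeing_above.finite_Lev[OF swap]])
  assume "card {C \<in> \<S>. C \<subseteq> B} = card {C \<in> \<T>. C \<subseteq> B}"
    and "\<And>i. i < n \<Longrightarrow> card {C \<in> Lev i \<S>. C \<subseteq> B} = card {C \<in> Lev i \<T>. C \<subseteq> B}"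
  then have "card (Lev n (graft B \<S> \<T>)) \<le> card (Lev n \<S>)"
    using split[OF fin_S] split[OF finite_Lev]
    by (intro forest_minimal_in_Lev_le[OF min mem]) (simp_all add: lev card_graft[OF fin_S fin_T])
  then show "card {C \<in> Lev n \<T>. C \<subseteq> B} \<le> card {C \<in> Lev n \<S>. C \<subseteq> B}"
    using split[OF finite_Lev, of n] by (simp add: lev)
qed

text \<open>Strong induction supplies equality on the earlier levels; the one-sided bounds are then
  applied to both forests via \<open>swap\<close>.\<close>

lemma minimal_inside_Lev_eq:
  assumes ch: "Ch \<S> = X" "Ch \<T> = X"
    and min_S: "forest_minimal_in \<S> {\<R>. finite \<R> \<and> \<R> \<subseteq> \<B> \<and> Ch \<R> = X}"
    and min_T: "forest_minimal_in \<T> {\<R>. finite \<R> \<and> \<R> \<subseteq> \<B> \<and> Ch \<R> = X}"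
  shows "card {C \<in> Lev n \<S>. C \<subseteq> B} = card {C \<in> Lev n \<T>. C \<subseteq> B}"
proof (induction n rule: less_induct)
  case (less n)
  have card: "card {C \<in> \<S>. C \<subseteq> B} = card {C \<in> \<T>. C \<subseteq> B}"
    using minimal_inside_Lev_le(1)[OF ch min_S]
      agreeing_above.minimal_inside_Lev_le(1)[OF swap ch(2,1) min_T] by simp
  show ?case
  proof (rule antisym)
    show "card {C \<in> Lev n \<S>. C \<subseteq> B} \<le> card {C \<in> Lev n \<T>. C \<subseteq> B}"
      by (rule agreeing_above.minimal_inside_Lev_le(2)[OF swap ch(2,1) min_T])
        (simp_all add: card less)
    show "card {C \<in> Lev n \<T>. C \<subseteq> B} \<le> card {C \<in> Lev n \<S>. C \<subseteq> B}"
      by (rule minimal_inside_Lev_le(2)[OF ch min_S]) (simp_all add: card less)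
  qed
qed

text \<open>On its own level \<open>d\<close>, the ball \<open>B\<close> is the only member of \<S>
  inside \<open>B\<close>, so \<T> also has exactly one ball \<open>E\<close> there. Every maximal
  ball of \<T> inside \<open>B\<close> has depth \<open>d\<close> and hence is
  \<open>E\<close>.\<close>

lemma single_root:
  assumes BS: "B \<in> \<S>" and BT: "B \<notin> \<T>"
    and lev_eq: "\<And>n. card {C \<in> Lev n \<S>. C \<subseteq> B} = card {C \<in> Lev n \<T>. C \<subseteq> B}"
  obtains E where "E \<in> \<T>" "E \<subset> B" "\<And>C. C \<in> \<T> \<Longrightarrow> C \<subseteq> B \<Longrightarrow> C \<subseteq> E"
proof -
  note lev_S = Lev_eq_depth[OF directed_family_subset[OF dir S_sub] fin_S]
  note lev_T = Lev_eq_depth[OF directed_family_subset[OF dir T_sub] fin_T]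
  define d where "d = depth \<S> B"
  have "{C \<in> Lev d \<S>. C \<subseteq> B} = {B}"
  proof (intro subset_antisym subsetI)
    fix C assume "C \<in> {C \<in> Lev d \<S>. C \<subseteq> B}"
    then show "C \<in> {B}"
      using depth_less[OF fin_S BS, of C] by (auto simp: lev_S d_def)
  qed (use BS in \<open>auto simp: lev_S d_def\<close>)
  then have "card {C \<in> Lev d \<T>. C \<subseteq> B} = 1"
    using lev_eq[of d] by simp
  then obtain E where E: "{C \<in> Lev d \<T>. C \<subseteq> B} = {E}"
    by (rule card_1_singletonE)
  have E_T: "E \<in> \<T>" "E \<subseteq> B"
    using E unfolding lev_T by auto
  have "C \<subseteq> E" if C: "C \<in> \<T>" "C \<subseteq> B" for C
  proof -
    \<comment> \<open>By maximality of \<open>D\<close>, a larger ball of \<T> leaves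
      \<open>B\<close> and so lies strictly above it; thus \<open>D\<close> in \<T> and
      \<open>B\<close> in \<S> have the same strict supersets.\<close>
    obtain D where D: "D \<in> \<T>" "C \<subseteq> D" "D \<subseteq> B"
        and max: "\<And>D'. D' \<in> \<T> \<Longrightarrow> D' \<subseteq> B \<Longrightarrow> D \<subseteq> D' \<Longrightarrow> D = D'"
      using finite_has_maximal2[of "{D \<in> \<T>. D \<subseteq> B}" C] fin_T C by auto
    obtain x where x: "x \<in> D"
      using directed_family_nonempty[OF dir] D(1) T_sub by blast
    have above: "B \<subset> D'" if "D' \<in> \<T>" "D \<subset> D'" for D'
      using above_if_meets[of D' x] max[of D'] that x D T_sub by auto
    have "D' \<in> \<T> \<and> D \<subset> D' \<longleftrightarrow> D' \<in> \<S> \<and> B \<subset> D'" for D'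
      using above[of D'] agree[of D'] subset_psubset_trans[OF D(3), of D'] by iprover
    then have "{D' \<in> \<T>. D \<subset> D'} = {D' \<in> \<S>. B \<subset> D'}"
      by simp
    then have "D \<in> Lev d \<T>"
      unfolding lev_T d_def depth_def using D by simp
    then show ?thesis
      using D E by auto
  qed
  moreover have "E \<subset> B"
    using E_T BT by auto
  ultimately show thesis
    using that[OF E_T(1)] by simp
qed

lemma single_root_smaller:
  assumes ch: "Ch \<S> = X" "Ch \<T> = X" and BS: "B \<in> \<S>"
    and ET: "E \<in> \<T>" and EB: "E \<subset> B" and below: "\<And>C. C \<in> \<T> \<Longrightarrow> C \<subseteq> B \<Longrightarrow> C \<subseteq> E"
  obtains \<R> where "finite \<R>" "\<R> \<subseteq> \<B>" "Ch \<R> = X" "card \<R> < card \<S>"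
proof -
  note parity = mem_Ch_iff_odd[OF directed_family_subset[OF dir]]
  have E_ball: "E \<in> \<B>"
    using ET T_sub by auto
  \<comment> \<open>Of the balls of \<S> inside \<open>B\<close>, those in \<open>I\<close> lie in
    \<open>E\<close>, those in \<open>M\<close> (\<open>B\<close> among them) strictly contain
    \<open>E\<close>, and the rest miss \<open>E\<close>. Dropping all but \<open>I\<close>
    therefore costs every point of \<open>E\<close> the same number \<open>card M\<close> of balls;
    \<open>J\<close> toggles \<open>E\<close> when that number is odd.\<close>
  define I where "I = {C \<in> \<S>. C \<subseteq> E}"
  define M where "M = {C \<in> \<S>. E \<subset> C \<and> C \<subseteq> B}"
  define J where "J = (if even (card M) then I else if E \<in> I then I - {E} else insert E I)"
  define \<R> where "\<R> = graft B \<S> J"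
  have fin: "finite I" "finite M" "finite J"
    unfolding J_def I_def M_def using fin_S by auto
  have J: "J \<subseteq> \<B>" "C \<in> J \<Longrightarrow> C \<subseteq> E" for C
    unfolding J_def I_def using S_sub E_ball by (auto split: if_splits)
  interpret R: agreeing_above U \<B> \<R> \<T> B
    using fin fin_S S_sub J agree dir fin_T T_sub B_ball
    unfolding \<R>_def graft_def by unfold_locales auto
  have card_J: "card J \<le> Suc (card I)"
    unfolding J_def using fin by (auto simp: card_insert_if)
  have inside_eq: "odd (card {C \<in> \<S>. x \<in> C}) \<longleftrightarrow> odd (card {C \<in> \<R>. x \<in> C})" if x: "x \<in> E" for x
  proof -
    define A where "A = {C \<in> \<S>. B \<subset> C}"
    have finA: "finite A"
      unfolding A_def using fin_S by simp
    have above: "B \<subset> C" if "C \<in> \<S>" "\<not> C \<subseteq> B" "x \<in> C" for C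
      using above_if_meets[of C x] that x EB S_sub by auto
    have between: "E \<subset> C" if "C \<in> \<S>" "\<not> C \<subseteq> E" "x \<in> C" for C
      using directed_family_comparable[OF dir E_ball, of C x] that x S_sub by auto
    \<comment> \<open>The balls through \<open>x\<close> are those above \<open>B\<close>, those in
      \<open>M\<close>, and those inside \<open>E\<close>. The first group survives in \<R>, so only
      the parity of the other two must be recovered from \<open>J\<close>.\<close>
    have "{C \<in> \<S>. x \<in> C} = (A \<union> M) \<union> {C \<in> I. x \<in> C}"
    proof (rule set_eqI)
      fix C
      show "C \<in> {C \<in> \<S>. x \<in> C} \<longleftrightarrow> C \<in> (A \<union> M) \<union> {C \<in> I. x \<in> C}"
        using above[of C] between[of C] x EB unfolding A_def M_def I_def by auto
    qed
    moreover have "card ((A \<union> M) \<union> {C \<in> I. x \<in> C}) = card A + card M + card {C \<in> I. x \<in> C}"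
    proof -
      have "A \<inter> M = {}" "(A \<union> M) \<inter> {C \<in> I. x \<in> C} = {}"
        using EB unfolding A_def M_def I_def by blast+
      then show ?thesis
        using fin finA by (simp add: card_Un_disjoint)
    qed
    moreover have "{C \<in> \<R>. x \<in> C} = A \<union> {C \<in> J. x \<in> C}"
    proof (rule set_eqI)
      fix C
      show "C \<in> {C \<in> \<R>. x \<in> C} \<longleftrightarrow> C \<in> A \<union> {C \<in> J. x \<in> C}"
        using above[of C] x EB J(2)[of C] unfolding A_def \<R>_def graft_def by auto
    qed
    moreover have "card (A \<union> {C \<in> J. x \<in> C}) = card A + card {C \<in> J. x \<in> C}"
      using fin finA EB J(2) unfolding A_def by (intro card_Un_disjoint) auto
    moreover have "odd (card {C \<in> J. x \<in> C}) \<longleftrightarrow> odd (card M + card {C \<in> I. x \<in> C})"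
    proof (cases "even (card M)")
      case True
      then show ?thesis by (simp add: J_def)
    next
      case False
      show ?thesis
      proof (cases "E \<in> I")
        case True
        then have "{C \<in> I. x \<in> C} = insert E {C \<in> J. x \<in> C}" "E \<notin> {C \<in> J. x \<in> C}"
          using False x by (auto simp: J_def)
        then show ?thesis using False fin by simp
      next
        case False': False
        then have "{C \<in> J. x \<in> C} = insert E {C \<in> I. x \<in> C}" "E \<notin> {C \<in> I. x \<in> C}"
          using False x by (auto simp: J_def)
        then show ?thesis using False fin by simp
      qed
    qed
    ultimately show ?thesis by (simp only: even_add) blast
  qed
  \<comment> \<open>All balls of \<T> inside \<open>B\<close> lie in \<open>E\<close>, so a point of
    \<open>B - E\<close> is covered in \<T> only by the common balls above \<open>B\<close>.\<close>
  have annulus_eq: "{C \<in> \<T>. x \<in> C} = {C \<in> \<S>. B \<subset> C}" if x: "x \<in> B" "x \<notin> E" for x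
  proof (rule Collect_cong)
    fix C
    show "C \<in> \<T> \<and> x \<in> C \<longleftrightarrow> C \<in> \<S> \<and> B \<subset> C"
      using above_if_meets[of C x] below[of C] agree[of C] x T_sub by auto
  qed
  have "Ch \<R> = X"
  proof (rule set_eqI)
    fix x
    consider "x \<in> E" | "x \<in> B" "x \<notin> E" | "x \<notin> B"
      by blast
    then have "odd (card {C \<in> \<R>. x \<in> C}) \<longleftrightarrow> x \<in> X"
    proof cases
      case 1
      then show ?thesis
        using inside_eq parity[OF S_sub fin_S] ch by simp
    next
      case 2
      have "{C \<in> \<R>. x \<in> C} = {C \<in> \<S>. B \<subset> C}"
      proof (rule Collect_cong)
        fix C
        show "C \<in> \<R> \<and> x \<in> C \<longleftrightarrow> C \<in> \<S> \<and> B \<subset> C"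
          using above_if_meets[of C x] J(2)[of C] 2 S_sub unfolding \<R>_def graft_def by auto
      qed
      then show ?thesis
        using annulus_eq[OF 2] parity[OF T_sub fin_T, of x] ch by simp
    next
      case 3
      then have "{C \<in> \<R>. x \<in> C} = {C \<in> \<S>. x \<in> C}"
        using J(2) EB unfolding \<R>_def graft_def by auto
      then show ?thesis
        using parity[OF S_sub fin_S, of x] ch by simp
    qed
    then show "x \<in> Ch \<R> \<longleftrightarrow> x \<in> X"
      by (simp add: parity[OF R.S_sub R.fin_S])
  qed
  moreover have "card \<R> < card \<S>"
  proof -
    obtain x where x: "x \<in> B" "x \<notin> E"
      using EB by auto
    \<comment> \<open>Otherwise \<open>B\<close> would be the only ball of \<S> through
      \<open>x\<close> that is not above \<open>B\<close>, and the two counts at \<open>x\<close>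
      would differ by one, against equal parities.\<close>
    have "\<exists>C\<in>\<S>. x \<in> C \<and> C \<subset> B"
    proof (rule ccontr)
      assume "\<not> ?thesis"
      then have "{C \<in> \<S>. x \<in> C} = insert B {C \<in> \<S>. B \<subset> C}"
        using above_if_meets[of _ x] x BS S_sub by auto
      then have "card {C \<in> \<S>. x \<in> C} = Suc (card {C \<in> \<T>. x \<in> C})"
        using fin_S annulus_eq[OF x] by simp
      then show False
        using parity[OF S_sub fin_S, of x] parity[OF T_sub fin_T, of x] ch by simp
    qed
    then obtain C where C: "C \<in> \<S>" "x \<in> C" "C \<subset> B"
      by blast
    \<comment> \<open>Both \<open>B\<close> and \<open>C\<close> are lost, while \<open>J\<close>
      has at most one ball more than \<open>I\<close>.\<close>
    have "card (insert B (insert C I)) = Suc (Suc (card I))"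
    proof -
      have "C \<notin> I" "B \<notin> insert C I"
        using C x EB unfolding I_def by auto
      then show ?thesis
        using fin by simp
    qed
    moreover have "card (insert B (insert C I)) \<le> card {C \<in> \<S>. C \<subseteq> B}"
      using C BS EB fin_S unfolding I_def by (intro card_mono) auto
    moreover have "card {C \<in> J. C \<subseteq> B} \<le> card J"
      using fin by (intro card_mono) auto
    ultimately show ?thesis
      using card_J card_graft[OF fin_S fin(3), of B]
        card_filter_add[OF fin_S, of "\<lambda>C. C \<subseteq> B"] unfolding \<R>_def by linarith
  qed
  ultimately show thesis
    using that R.fin_S R.S_sub by blast
qed

lemma minimal_mem:
  assumes ch: "Ch \<S> = X" "Ch \<T> = X"
    and min_S: "forest_minimal_in \<S> {\<R>. finite \<R> \<and> \<R> \<subseteq> \<B> \<and> Ch \<R> = X}"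
    and min_T: "forest_minimal_in \<T> {\<R>. finite \<R> \<and> \<R> \<subseteq> \<B> \<and> Ch \<R> = X}"
    and BS: "B \<in> \<S>"
  shows "B \<in> \<T>"
proof (rule ccontr)
  assume "B \<notin> \<T>"
  then obtain E where "E \<in> \<T>" "E \<subset> B" "\<And>C. C \<in> \<T> \<Longrightarrow> C \<subseteq> B \<Longrightarrow> C \<subseteq> E"
    using single_root[OF BS _ minimal_inside_Lev_eq[OF ch min_S min_T]] by blast
  then obtain \<R> where "finite \<R>" "\<R> \<subseteq> \<B>" "Ch \<R> = X" "card \<R> < card \<S>"
    using single_root_smaller[OF ch BS] by blast
  then show False
    using forest_minimal_in_card_le[OF min_S, of \<R>] by simp
qed

end

section \<open>Uniqueness, from a maximal ball of the symmetric difference\<close>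

theorem theorem3p1:
  fixes U X :: "'a set" and \<B> \<S> \<T> :: "'a set set"
  assumes "directed_family U \<B>"
    and "U \<in> \<B>"
    and "X \<subseteq> U"
    and "constructible U \<B> X"
    and "finite \<S>" and "\<S> \<subseteq> \<B>" and "Ch \<S> = X"
    and "finite \<T>" and "\<T> \<subseteq> \<B>" and "Ch \<T> = X"
    and "forest_minimal_in \<S> {\<R>. finite \<R> \<and> \<R> \<subseteq> \<B> \<and> Ch \<R> = X}"
    and "forest_minimal_in \<T> {\<R>. finite \<R> \<and> \<R> \<subseteq> \<B> \<and> Ch \<R> = X}"
  shows "\<S> = \<T>"
proof (rule ccontr)
  let ?D = "(\<S> - \<T>) \<union> (\<T> - \<S>)"
  assume "\<S> \<noteq> \<T>"
  then have "?D \<noteq> {}" "finite ?D"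
    using assms(5,8) by auto
  then obtain B where B: "B \<in> ?D" and max: "\<forall>C\<in>?D. B \<subseteq> C \<longrightarrow> B = C"
    using finite_has_maximal[of ?D] by blast
  \<comment> \<open>Maximality of \<open>B\<close> in the symmetric difference is precisely
    agreement of the two forests above \<open>B\<close>.\<close>
  interpret agreeing_above U \<B> \<S> \<T> B
    using assms B max by unfold_locales auto
  show False
    using B minimal_mem[OF assms(7,10,11,12)]
      agreeing_above.minimal_mem[OF swap assms(10,7,12,11)] by blast
qed

end
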